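(* Let $\boldsymbol\mu=(\mu_1,\dots,\mu_k)$ be a valuated flag matroid on $[n]$ with underlying flag matroid $\boldsymbol M=(M_1,\dots,M_k)$. Then the weight $w(B_1,\dots,B_k)=\sum_{i=1}^k\mu_i(B_i)$ on the base configuration $\mathcal B(\boldsymbol M)$ induces a flag matroidal subdivision of $\mathcal B(\boldsymbol M)$: for every $u\in\mathbb R^n$, the set of tuples $(B_1,\dots,B_k)\in\mathcal B(M_1)\times\cdots\times\mathcal B(M_k)$ minimizing $\sum_{i=1}^k\big(\mu_i(B_i)+\langle u,\mathbf e_{B_i}\rangle\big)$ equals $\mathcal B(N_1)\times\cdots\times\mathcal B(N_k)$ for some flag matroid $(N_1,\dots,N_k)$ on $[n]$.
   Context: $\mathbb T=\mathbb R\cup\{\infty\}$, $\mathbf e_B=\sum_{i\in B}\mathbf e_i$. A valuated matroid of rank $r$ on $[n]$ is $\mu:\binom{[n]}{r}\to\mathbb T$ such that $\mathcal B(M)=\{I:\mu(I)\ne\infty\}$ is the set of bases of a matroid $M$ (underlying matroid) and for all $B,B'\in\mathcal B(M)$, $i\in B\setminus B'$ there is $j\in B'\setminus B$ with $\mu(B)+\mu(B')\ge\mu(B\setminus i\cup j)+\mu(B'\setminus j\cup i)$. For valuated matroids $\mu,\nu$ of ranks $r\le s$ with underlying $M,N$, $\mu\twoheadleftarrow\nu$ means: for all $I\in\mathcal B(M)$, $J\in\mathcal B(N)$, $i\in I\setminus J$ there is $j\in J\setminus I$ with $\mu(I)+\nu(J)\ge\mu(I\setminus i\cup j)+\nu(J\setminus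 j\cup i)$. A valuated flag matroid is $(\mu_1,\dots,\mu_k)$ with $\mu_i\twoheadleftarrow\mu_j$ for $i<j$; its underlying flag matroid is the sequence of underlying matroids. A flag matroid is a sequence $(N_1,\dots,N_k)$ of matroids on $[n]$ such that for all $i<j$ every circuit of $N_j$ is a union of circuits of $N_i$. The base configuration of a flag matroid $\boldsymbol M$ is the point configuration indexed by $\mathcal B(M_1)\times\cdots\times\mathcal B(M_k)$ with $(B_1,\dots,B_k)\mapsto\sum_i\mathbf e_{B_i}\in\mathbb R^n$. *)

theory Defs
  imports Complex_Main "HOL-Library.Extended_Real" "HOL-Library.FuncSet"
    "HOL-Library.Indicator_Function"
begin

text \<open>
  A matroid on \<open>E\<close> is represented by its set of bases. Sequences indexed by \<open>1, \<dots>, k\<close> are functions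
  on \<open>nat\<close> of which only the values on \<open>{1..k}\<close> are used.
\<close>

definition matroid_bases :: "'a set \<Rightarrow> 'a set set \<Rightarrow> bool" where
  "matroid_bases E \<B> \<longleftrightarrow>
     finite E \<and> \<B> \<noteq> {} \<and> (\<forall>B\<in>\<B>. B \<subseteq> E) \<and>
     (\<forall>B\<in>\<B>. \<forall>B'\<in>\<B>. \<forall>i\<in>B - B'. \<exists>j\<in>B' - B. insert j (B - {i}) \<in> \<B>)"

definition dependent_sets :: "'a set \<Rightarrow> 'a set set \<Rightarrow> 'a set set" where
  "dependent_sets E \<B> = {D. D \<subseteq> E \<and> \<not> (\<exists>B\<in>\<B>. D \<subseteq> B)}"

definition circuits :: "'a set \<Rightarrow> 'a set set \<Rightarrow> 'a set set" where
  "circuits E \<B> = {C \<in> dependent_sets E \<B>. \<forall>D\<in>dependent_sets E \<B>. D \<subseteq> C \<longrightarrow> D = C}"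

definition flag_matroid :: "'a set \<Rightarrow> nat \<Rightarrow> (nat \<Rightarrow> 'a set set) \<Rightarrow> bool" where
  "flag_matroid E k N \<longleftrightarrow>
     (\<forall>i\<in>{1..k}. matroid_bases E (N i)) \<and>
     (\<forall>i\<in>{1..k}. \<forall>j\<in>{1..k}. i < j \<longrightarrow>
        (\<forall>C\<in>circuits E (N j). \<exists>\<C>\<subseteq>circuits E (N i). C = \<Union>\<C>))"

text \<open>
  Values in \<open>\<real> \<union> {\<infinity>}\<close> are extended reals other than \<open>-\<infinity>\<close>. Only the values of \<open>\<mu>\<close> on the
  \<open>r\<close>-element subsets of \<open>E\<close> are used.
\<close>

definition val_bases :: "'a set \<Rightarrow> nat \<Rightarrow> ('a set \<Rightarrow> ereal) \<Rightarrow> 'a set set" where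
  "val_bases E r \<mu> = {I. I \<subseteq> E \<and> card I = r \<and> \<mu> I \<noteq> \<infinity>}"

definition valuated_matroid :: "'a set \<Rightarrow> nat \<Rightarrow> ('a set \<Rightarrow> ereal) \<Rightarrow> bool" where
  "valuated_matroid E r \<mu> \<longleftrightarrow>
     (\<forall>I. I \<subseteq> E \<and> card I = r \<longrightarrow> \<mu> I \<noteq> -\<infinity>) \<and>
     matroid_bases E (val_bases E r \<mu>) \<and>
     (\<forall>B\<in>val_bases E r \<mu>. \<forall>B'\<in>val_bases E r \<mu>. \<forall>i\<in>B - B'. \<exists>j\<in>B' - B.
        \<mu> B + \<mu> B' \<ge> \<mu> (insert j (B - {i})) + \<mu> (insert i (B' - {j})))"

definition valuated_quotient ::
    "'a set \<Rightarrow> nat \<Rightarrow> ('a set \<Rightarrow> ereal) \<Rightarrow> nat \<Rightarrow> ('a set \<Rightarrow> ereal) \<Rightarrow> bool" where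
  "valuated_quotient E r \<mu> s \<nu> \<longleftrightarrow>
     r \<le> s \<and>
     (\<forall>I\<in>val_bases E r \<mu>. \<forall>J\<in>val_bases E s \<nu>. \<forall>i\<in>I - J. \<exists>j\<in>J - I.
        \<mu> I + \<nu> J \<ge> \<mu> (insert j (I - {i})) + \<nu> (insert i (J - {j})))"

definition valuated_flag_matroid ::
    "'a set \<Rightarrow> nat \<Rightarrow> (nat \<Rightarrow> nat) \<Rightarrow> (nat \<Rightarrow> 'a set \<Rightarrow> ereal) \<Rightarrow> bool" where
  "valuated_flag_matroid E k r \<mu> \<longleftrightarrow>
     (\<forall>i\<in>{1..k}. valuated_matroid E (r i) (\<mu> i)) \<and>
     (\<forall>i\<in>{1..k}. \<forall>j\<in>{1..k}. i < j \<longrightarrow> valuated_quotient E (r i) (\<mu> i) (r j) (\<mu> j))"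

definition underlying_flag ::
    "'a set \<Rightarrow> (nat \<Rightarrow> nat) \<Rightarrow> (nat \<Rightarrow> 'a set \<Rightarrow> ereal) \<Rightarrow> nat \<Rightarrow> 'a set set" where
  "underlying_flag E r \<mu> i = val_bases E (r i) (\<mu> i)"

text \<open>
  Vectors in \<open>\<real>\<^sup>E\<close> are functions \<open>'a \<Rightarrow> real\<close> of which only the coordinates in \<open>E\<close> matter; the
  vector \<open>e\<^sub>B\<close> is \<open>indicator B\<close>. The base configuration consists of the index set \<open>base_tuples k M\<close>
  and the map \<open>base_point k\<close>.
\<close>

definition inner_on :: "'a set \<Rightarrow> ('a \<Rightarrow> real) \<Rightarrow> ('a \<Rightarrow> real) \<Rightarrow> real" where
  "inner_on E u x = (\<Sum>e\<in>E. u e * x e)"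

definition base_tuples :: "nat \<Rightarrow> (nat \<Rightarrow> 'a set set) \<Rightarrow> (nat \<Rightarrow> 'a set) set" where
  "base_tuples k M = (\<Pi>\<^sub>E i\<in>{1..k}. M i)"

definition base_point :: "nat \<Rightarrow> (nat \<Rightarrow> 'a set) \<Rightarrow> 'a \<Rightarrow> real" where
  "base_point k B = (\<lambda>e. \<Sum>i = 1..k. indicator (B i) e)"

text \<open>
  The cells of the regular subdivision of a point configuration \<open>a\<close>, indexed by \<open>S\<close>, that is induced
  by a weight \<open>w\<close>. Cells are sets of indices, since \<open>a\<close> need not be injective.
\<close>

definition regular_subdivision ::
    "'a set \<Rightarrow> 'b set \<Rightarrow> ('b \<Rightarrow> 'a \<Rightarrow> real) \<Rightarrow> ('b \<Rightarrow> ereal) \<Rightarrow> 'b set set" where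
  "regular_subdivision E S a w =
     range (\<lambda>u. {b. is_arg_min (\<lambda>b. w b + ereal (inner_on E u (a b))) (\<lambda>b. b \<in> S) b})"

definition flag_matroidal :: "'a set \<Rightarrow> nat \<Rightarrow> (nat \<Rightarrow> 'a set) set set \<Rightarrow> bool" where
  "flag_matroidal E k \<S> \<longleftrightarrow>
     (\<forall>F\<in>\<S>. \<exists>N. flag_matroid E k N \<and> F = base_tuples k N)"

end

theory Submission
  imports Defs
begin

text \<open>
  The minimizers of a separable function on a product form the product of the sets of minimizers, so
  the cell of \<open>u\<close> is a product of sets \<open>N\<^sub>i\<close>. Both sides of the valuated exchange inequality change
  by the same amount under the tilt by \<open>u\<close>; applied to two minimizers it therefore produces two
  minimizers. This is basis exchange within \<open>N\<^sub>i\<close>, and between \<open>N\<^sub>i\<close> and \<open>N\<^sub>j\<close>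
  for \<open>i < j\<close> it is a simultaneous exchange property. The latter forces every circuit of \<open>N\<^sub>j\<close>
  to be a union of circuits of \<open>N\<^sub>i\<close>.
\<close>

section \<open>Circuits and simultaneous exchange\<close>

lemma card_exchange:
  assumes "finite A" "i \<in> A" "j \<notin> A"
  shows "card (insert j (A - {i})) = card A"
  using assms card_Suc_Diff1[of A i] by simp

lemma dependent_set_contains_circuit:
  assumes "finite E" "D \<in> dependent_sets E \<B>"
  obtains C where "C \<in> circuits E \<B>" "C \<subseteq> D"
proof -
  have "finite D"
    using assms unfolding dependent_sets_def by (auto intro: finite_subset)
  then have "finite {X \<in> dependent_sets E \<B>. X \<subseteq> D}"
    by (auto intro: finite_subset[of _ "Pow D"])
  from finite_has_minimal2[OF this, of D] assms(2)
  obtain C where C: "C \<in> dependent_sets E \<B>" "C \<subseteq> D"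
    and "\<forall>X\<in>{X \<in> dependent_sets E \<B>. X \<subseteq> D}. X \<subseteq> C \<longrightarrow> C = X"
    by auto
  then have "C \<in> circuits E \<B>"
    unfolding circuits_def by blast
  with C(2) show thesis by (rule that[rotated])
qed

text \<open>If no circuit of \<open>\<A>\<close> inside \<open>C\<close> passed through some
  \<open>e\<close> of \<open>C\<close>, every member of \<open>\<A>\<close> with largest trace on
  \<open>C\<close> would contain \<open>e\<close>. Simultaneous exchange with a member of
  \<open>\<B>\<close> that contains \<open>C - {e}\<close> swaps \<open>e\<close> for another
  element of \<open>C\<close>, which keeps the size of the trace but loses \<open>e\<close>. Hence
  the circuits of \<open>\<A>\<close> within \<open>C\<close> cover \<open>C\<close>.\<close>

lemma circuit_union_of_circuits:
  assumes fin: "finite E" and ne: "\<A> \<noteq> {}" and subE: "\<And>I. I \<in> \<A> \<Longrightarrow> I \<subseteq> E"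
    and exch: "\<And>I J i. \<lbrakk>I \<in> \<A>; J \<in> \<B>; i \<in> I - J\<rbrakk> \<Longrightarrow>
      \<exists>j\<in>J - I. insert j (I - {i}) \<in> \<A> \<and> insert i (J - {j}) \<in> \<B>"
    and C: "C \<in> circuits E \<B>"
  shows "\<exists>\<C>\<subseteq>circuits E \<A>. C = \<Union>\<C>"
proof -
  have CE: "C \<subseteq> E" and Cdep: "\<And>B. B \<in> \<B> \<Longrightarrow> \<not> C \<subseteq> B"
    and Cmin: "\<And>D. \<lbrakk>D \<in> dependent_sets E \<B>; D \<subseteq> C\<rbrakk> \<Longrightarrow> D = C"
    using C unfolding circuits_def dependent_sets_def by auto
  have finC: "finite C"
    using CE fin by (rule finite_subset)
  have "\<exists>D\<in>circuits E \<A>. D \<subseteq> C \<and> e \<in> D" if e: "e \<in> C" for e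
  proof (rule ccontr)
    assume no: "\<not> ?thesis"
    \<comment> \<open>Minimality of \<open>C\<close> makes \<open>C - {e}\<close> independent in
      \<open>\<B>\<close>. The \<open>J\<close> extending it must miss \<open>e\<close>, since
      otherwise it would contain \<open>C\<close>.\<close>
    have "C - {e} \<notin> dependent_sets E \<B>"
      using Cmin[of "C - {e}"] e by blast
    then obtain J where J: "J \<in> \<B>" "C - {e} \<subseteq> J"
      using CE unfolding dependent_sets_def by blast
    have eJ: "e \<notin> J"
      using Cdep[OF J(1)] J(2) by blast
    \<comment> \<open>\<open>e\<close> is a coloop of the restriction of \<open>\<A>\<close> to \<open>C\<close>.\<close>
    have coloop: "e \<in> I"
      if I: "I \<in> \<A>" and Imax: "\<And>I'. I' \<in> \<A> \<Longrightarrow> card (I' \<inter> C) \<le> card (I \<inter> C)" for I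
    proof (rule ccontr)
      assume eI: "e \<notin> I"
      \<comment> \<open>A member of \<open>\<A>\<close> containing this set would beat
        \<open>I\<close> on \<open>C\<close>, so the set is dependent. A circuit in it cannot lie
        inside \<open>I\<close> and therefore uses \<open>e\<close>.\<close>
      have "\<not> insert e (I \<inter> C) \<subseteq> I'" if "I' \<in> \<A>" for I'
      proof
        assume "insert e (I \<inter> C) \<subseteq> I'"
        then have "I \<inter> C \<subset> I' \<inter> C"
          using e eI by blast
        then have "card (I \<inter> C) < card (I' \<inter> C)"
          using finC by (intro psubset_card_mono) auto
        with Imax[OF that] show False by simp
      qed
      then have "insert e (I \<inter> C) \<in> dependent_sets E \<A>"
        using e CE unfolding dependent_sets_def by blast
      from dependent_set_contains_circuit[OF fin this]
      obtain D where D: "D \<in> circuits E \<A>" "D \<subseteq> insert e (I \<inter> C)" .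
      have "\<not> D \<subseteq> I"
        using D(1) I unfolding circuits_def dependent_sets_def by blast
      with D no e show False by blast
    qed
    have "finite \<A>"
      using subE fin by (auto intro: finite_subset[of _ "Pow E"])
    then have finim: "finite ((\<lambda>I. card (I \<inter> C)) ` \<A>)" by simp
    then have "Max ((\<lambda>I. card (I \<inter> C)) ` \<A>) \<in> (\<lambda>I. card (I \<inter> C)) ` \<A>"
      using ne by (intro Max_in) auto
    then obtain I where I: "I \<in> \<A>" and IMax: "card (I \<inter> C) = Max ((\<lambda>I. card (I \<inter> C)) ` \<A>)"
      by force
    have Imax: "card (I' \<inter> C) \<le> card (I \<inter> C)" if "I' \<in> \<A>" for I'
      unfolding IMax using finim that by (intro Max_ge) auto
    have eI: "e \<in> I"
      using coloop[OF I Imax] .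
    obtain j where j: "j \<in> J - I" "insert j (I - {e}) \<in> \<A>" "insert e (J - {j}) \<in> \<B>"
      using exch[OF I J(1), of e] eI eJ by blast
    \<comment> \<open>\<open>J\<close> contains \<open>C - {e}\<close>, so if \<open>j\<close> were
      outside \<open>C\<close>, adding \<open>e\<close> and deleting \<open>j\<close> would give a
      member of \<open>\<B>\<close> containing \<open>C\<close>.\<close>
    have jC: "j \<in> C"
      using Cdep[OF j(3)] J(2) by blast
    \<comment> \<open>The trace keeps its size, so the new member is again maximal on
      \<open>C\<close> and ought to contain \<open>e\<close>; but \<open>j \<noteq> e\<close>, since
      \<open>J\<close> contains \<open>j\<close> and not \<open>e\<close>.\<close>
    have "insert j (I - {e}) \<inter> C = insert j (I \<inter> C - {e})"
      using jC by blast
    moreover have "card (insert j (I \<inter> C - {e})) = card (I \<inter> C)"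
      using j(1) e eI finC by (intro card_exchange) auto
    ultimately have "e \<in> insert j (I - {e})"
      using coloop[OF j(2)] Imax by simp
    with j(1) eJ show False by auto
  qed
  then have "C = \<Union>{D \<in> circuits E \<A>. D \<subseteq> C}" by blast
  then show ?thesis
    by (intro exI[of _ "{D \<in> circuits E \<A>. D \<subseteq> C}"]) simp
qed

section \<open>Initial matroids of a valuated matroid\<close>

text \<open>
  The extended values are replaced by real ones; they agree on \<open>val_bases E r \<mu>\<close> when \<open>\<mu>\<close> is a
  valuated matroid.
\<close>

definition tilted_value :: "('a set \<Rightarrow> ereal) \<Rightarrow> ('a \<Rightarrow> real) \<Rightarrow> 'a set \<Rightarrow> real" where
  "tilted_value \<mu> u B = real_of_ereal (\<mu> B) + sum u B"

text \<open>For a valuated matroid these are the bases of its initial matroid at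
  \<open>u\<close>.\<close>

definition initial_bases ::
    "'a set \<Rightarrow> nat \<Rightarrow> ('a set \<Rightarrow> ereal) \<Rightarrow> ('a \<Rightarrow> real) \<Rightarrow> 'a set set" where
  "initial_bases E r \<mu> u = {B. is_arg_min (tilted_value \<mu> u) (\<lambda>B. B \<in> val_bases E r \<mu>) B}"

lemma initial_bases_iff:
  "B \<in> initial_bases E r \<mu> u \<longleftrightarrow>
     B \<in> val_bases E r \<mu> \<and> (\<forall>B'\<in>val_bases E r \<mu>. tilted_value \<mu> u B \<le> tilted_value \<mu> u B')"
  unfolding initial_bases_def is_arg_min_def by (auto simp: not_less)

lemma valuated_matroid_value:
  assumes "valuated_matroid E r \<mu>" "B \<in> val_bases E r \<mu>"
  shows "\<mu> B = ereal (real_of_ereal (\<mu> B))"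
proof -
  have "\<mu> B \<noteq> -\<infinity>" "\<mu> B \<noteq> \<infinity>"
    using assms unfolding valuated_matroid_def val_bases_def by blast+
  then show ?thesis by (cases "\<mu> B") auto
qed

text \<open>The exchanged sets have tilted values whose sum is at most the sum of the two minima, so
  each of them attains its own minimum. The case of equal valuations is basis exchange, that of a
  quotient links two constituents of the flag.\<close>

lemma initial_bases_exchange:
  assumes fin: "finite E"
    and \<mu>: "valuated_matroid E r \<mu>" and \<nu>: "valuated_matroid E s \<nu>"
    and q: "valuated_quotient E r \<mu> s \<nu>"
    and I: "I \<in> initial_bases E r \<mu> u" and J: "J \<in> initial_bases E s \<nu> u" and i: "i \<in> I - J"
  shows "\<exists>j\<in>J - I. insert j (I - {i}) \<in> initial_bases E r \<mu> u \<and>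
                   insert i (J - {j}) \<in> initial_bases E s \<nu> u"
proof -
  have Ib: "I \<in> val_bases E r \<mu>" and Jb: "J \<in> val_bases E s \<nu>"
    using I J unfolding initial_bases_iff by auto
  then have IE: "I \<subseteq> E" "card I = r" and JE: "J \<subseteq> E" "card J = s"
    unfolding val_bases_def by auto
  then have finI: "finite I" and finJ: "finite J"
    using fin by (auto intro: finite_subset)
  obtain j where j: "j \<in> J - I"
    and le: "\<mu> (insert j (I - {i})) + \<nu> (insert i (J - {j})) \<le> \<mu> I + \<nu> J"
    using q Ib Jb i unfolding valuated_quotient_def by blast
  define I' J' where "I' = insert j (I - {i})" and "J' = insert i (J - {j})"
  have I'E: "I' \<subseteq> E" "card I' = r" and J'E: "J' \<subseteq> E" "card J' = s"
    using IE JE i j card_exchange[OF finI, of i j] card_exchange[OF finJ, of j i]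
    unfolding I'_def J'_def by auto
  have "\<mu> I' \<noteq> -\<infinity>" "\<nu> J' \<noteq> -\<infinity>"
    using \<mu> \<nu> I'E J'E unfolding valuated_matroid_def by blast+
  \<comment> \<open>The bound is a real number, so neither value on the left can be
    \<open>\<infinity>\<close>. This is what makes \<open>I'\<close> and \<open>J'\<close> bases of
    the underlying matroids.\<close>
  moreover have le': "\<mu> I' + \<nu> J' \<le> ereal (real_of_ereal (\<mu> I) + real_of_ereal (\<nu> J))"
    using le unfolding I'_def[symmetric] J'_def[symmetric] plus_ereal.simps(1)[symmetric]
      valuated_matroid_value[OF \<mu> Ib, symmetric] valuated_matroid_value[OF \<nu> Jb, symmetric] .
  ultimately have "\<mu> I' \<noteq> \<infinity>" "\<nu> J' \<noteq> \<infinity>"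
    by auto
  then have I'b: "I' \<in> val_bases E r \<mu>" and J'b: "J' \<in> val_bases E s \<nu>"
    using I'E J'E unfolding val_bases_def by auto
  have "real_of_ereal (\<mu> I') + real_of_ereal (\<nu> J') \<le> real_of_ereal (\<mu> I) + real_of_ereal (\<nu> J)"
    unfolding ereal_less_eq(3)[symmetric] plus_ereal.simps(1)[symmetric]
      valuated_matroid_value[OF \<mu> I'b, symmetric] valuated_matroid_value[OF \<nu> J'b, symmetric]
    using le' by simp
  \<comment> \<open>The elements \<open>i\<close> and \<open>j\<close> only change places between
    the two sets, so the tilt cancels from the inequality.\<close>
  moreover have "sum u I' + sum u J' = sum u I + sum u J"
    using i j finI finJ unfolding I'_def J'_def by (simp add: sum_diff1)
  ultimately have "tilted_value \<mu> u I' + tilted_value \<nu> u J'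
      \<le> tilted_value \<mu> u I + tilted_value \<nu> u J"
    unfolding tilted_value_def by simp
  moreover have "tilted_value \<mu> u I \<le> tilted_value \<mu> u B" if "B \<in> val_bases E r \<mu>" for B
    using I that unfolding initial_bases_iff by blast
  moreover have "tilted_value \<nu> u J \<le> tilted_value \<nu> u B" if "B \<in> val_bases E s \<nu>" for B
    using J that unfolding initial_bases_iff by blast
  ultimately have "tilted_value \<mu> u I' \<le> tilted_value \<mu> u I"
    and "tilted_value \<nu> u J' \<le> tilted_value \<nu> u J"
    using I'b J'b by fastforce+
  then have "I' \<in> initial_bases E r \<mu> u" "J' \<in> initial_bases E s \<nu> u"
    using I J I'b J'b unfolding initial_bases_iff by (blast intro: order_trans)+
  with j show ?thesis
    unfolding I'_def J'_def by blast
qed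

lemma initial_bases_matroid:
  assumes "valuated_matroid E r \<mu>"
  shows "matroid_bases E (initial_bases E r \<mu> u)"
proof -
  have m: "matroid_bases E (val_bases E r \<mu>)"
    using assms unfolding valuated_matroid_def by blast
  then have fin: "finite E" and ne: "val_bases E r \<mu> \<noteq> {}"
    unfolding matroid_bases_def by auto
  \<comment> \<open>The exchange axiom of a valuated matroid says that it is a quotient of
    itself.\<close>
  have q: "valuated_quotient E r \<mu> r \<mu>"
    using assms unfolding valuated_matroid_def valuated_quotient_def by simp
  have "finite (val_bases E r \<mu>)"
    using fin unfolding val_bases_def by (auto intro: finite_subset[of _ "Pow E"])
  from ex_is_arg_min_if_finite[OF this ne]
  have "initial_bases E r \<mu> u \<noteq> {}"
    unfolding initial_bases_def by blast
  moreover have "B \<subseteq> E" if "B \<in> initial_bases E r \<mu> u" for B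
    using that unfolding initial_bases_iff val_bases_def by simp
  moreover have "\<exists>j\<in>B' - B. insert j (B - {i}) \<in> initial_bases E r \<mu> u"
    if "B \<in> initial_bases E r \<mu> u" "B' \<in> initial_bases E r \<mu> u" "i \<in> B - B'" for B B' i
    using initial_bases_exchange[OF fin assms assms q that] by blast
  ultimately show ?thesis
    unfolding matroid_bases_def using fin by simp
qed

lemma initial_bases_flag_matroid:
  assumes "valuated_flag_matroid E k r \<mu>"
  shows "flag_matroid E k (\<lambda>i. initial_bases E (r i) (\<mu> i) u)"
  unfolding flag_matroid_def
proof (intro conjI ballI impI)
  fix i assume "i \<in> {1..k}"
  then show "matroid_bases E (initial_bases E (r i) (\<mu> i) u)"
    using assms unfolding valuated_flag_matroid_def by (blast intro: initial_bases_matroid)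
next
  fix i j C
  assume ij: "i \<in> {1..k}" "j \<in> {1..k}" "i < j"
    and C: "C \<in> circuits E (initial_bases E (r j) (\<mu> j) u)"
  have vi: "valuated_matroid E (r i) (\<mu> i)" and vj: "valuated_matroid E (r j) (\<mu> j)"
    and q: "valuated_quotient E (r i) (\<mu> i) (r j) (\<mu> j)"
    using assms ij unfolding valuated_flag_matroid_def by auto
  have m: "finite E" "initial_bases E (r i) (\<mu> i) u \<noteq> {}"
    "\<And>I. I \<in> initial_bases E (r i) (\<mu> i) u \<Longrightarrow> I \<subseteq> E"
    using initial_bases_matroid[OF vi] unfolding matroid_bases_def by auto
  show "\<exists>\<C>\<subseteq>circuits E (initial_bases E (r i) (\<mu> i) u). C = \<Union>\<C>"
    by (rule circuit_union_of_circuits[OF m initial_bases_exchange[OF m(1) vi vj q] C])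
qed

section \<open>Minimization over a product\<close>

lemma is_arg_min_sum_PiE:
  fixes f :: "'i \<Rightarrow> 'b \<Rightarrow> real"
  assumes "finite I"
  shows "{B. is_arg_min (\<lambda>B. \<Sum>i\<in>I. f i (B i)) (\<lambda>B. B \<in> Pi\<^sub>E I M) B}
       = (\<Pi>\<^sub>E i\<in>I. {b. is_arg_min (f i) (\<lambda>b. b \<in> M i) b})"
proof (intro equalityI subsetI)
  fix B assume "B \<in> {B. is_arg_min (\<lambda>B. \<Sum>i\<in>I. f i (B i)) (\<lambda>B. B \<in> Pi\<^sub>E I M) B}"
  then have B: "B \<in> Pi\<^sub>E I M"
    and min: "\<And>B'. B' \<in> Pi\<^sub>E I M \<Longrightarrow> (\<Sum>i\<in>I. f i (B i)) \<le> (\<Sum>i\<in>I. f i (B' i))"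
    unfolding is_arg_min_def by (auto simp: not_less)
  have "f i (B i) \<le> f i b" if i: "i \<in> I" and b: "b \<in> M i" for i b
  proof -
    \<comment> \<open>Only coordinate \<open>i\<close> of the minimizer is varied; all other
      summands then cancel.\<close>
    have "B(i := b) \<in> Pi\<^sub>E I M"
      using B i b by (auto simp: PiE_iff extensional_def)
    from min[OF this] show ?thesis
      using assms i by (simp add: sum.remove[of I i])
  qed
  with B show "B \<in> (\<Pi>\<^sub>E i\<in>I. {b. is_arg_min (f i) (\<lambda>b. b \<in> M i) b})"
    unfolding is_arg_min_def by (auto simp: PiE_iff not_less)
next
  fix B assume B: "B \<in> (\<Pi>\<^sub>E i\<in>I. {b. is_arg_min (f i) (\<lambda>b. b \<in> M i) b})"
  have "(\<Sum>i\<in>I. f i (B i)) \<le> (\<Sum>i\<in>I. f i (B' i))" if "B' \<in> Pi\<^sub>E I M" for B'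
    using B that by (intro sum_mono) (auto simp: PiE_iff is_arg_min_def not_less)
  with B show "B \<in> {B. is_arg_min (\<lambda>B. \<Sum>i\<in>I. f i (B i)) (\<lambda>B. B \<in> Pi\<^sub>E I M) B}"
    unfolding is_arg_min_def mem_Collect_eq not_ex de_Morgan_conj not_less
    by (blast intro: PiE_mem PiE_arb)
qed

text \<open>Passes from extended real objectives to real ones, for which the product lemma is
  stated.\<close>

lemma is_arg_min_cong_ereal:
  assumes "\<And>x. P x \<Longrightarrow> g x = ereal (f x)"
  shows "{x. is_arg_min g P x} = {x. is_arg_min f P x}"
  using assms unfolding is_arg_min_def by auto

lemma inner_on_indicator:
  assumes "finite E" "B \<subseteq> E"
  shows "inner_on E u (indicator B) = sum u B"
  unfolding inner_on_def using assms by (simp add: Int_absorb1)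

lemma inner_on_base_point:
  "inner_on E u (base_point k B) = (\<Sum>i = 1..k. inner_on E u (indicator (B i)))"
  unfolding inner_on_def base_point_def sum_distrib_left by (rule sum.swap)

section \<open>The cells of the subdivision\<close>

theorem theorem4p19:
  fixes n k :: nat
    and r :: "nat \<Rightarrow> nat"
    and \<mu> :: "nat \<Rightarrow> nat set \<Rightarrow> ereal"
    and M :: "nat \<Rightarrow> nat set set"
  assumes "valuated_flag_matroid {1..n} k r \<mu>"
    and "\<And>i. i \<in> {1..k} \<Longrightarrow> M i = underlying_flag {1..n} r \<mu> i"
  shows "flag_matroidal {1..n} k
           (regular_subdivision {1..n} (base_tuples k M) (base_point k)
              (\<lambda>B. \<Sum>i = 1..k. \<mu> i (B i)))
         \<and> (\<forall>u :: nat \<Rightarrow> real. \<exists>N. flag_matroid {1..n} k N \<and>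
              {B. is_arg_min
                    (\<lambda>B. \<Sum>i = 1..k. (\<mu> i (B i) + ereal (inner_on {1..n} u (indicator (B i)))))
                    (\<lambda>B. B \<in> base_tuples k M) B}
              = base_tuples k N)"
proof -
  let ?E = "{1..n}"
  have M: "base_tuples k M = (\<Pi>\<^sub>E i\<in>{1..k}. val_bases ?E (r i) (\<mu> i))"
    unfolding base_tuples_def using assms(2) by (intro PiE_cong) (simp add: underlying_flag_def)
  \<comment> \<open>The constituents of the cell at \<open>u\<close> are the initial matroids, all
    taken at the same \<open>u\<close>.\<close>
  define N where "N u = (\<lambda>i. initial_bases ?E (r i) (\<mu> i) u)" for u
  have N: "flag_matroid ?E k (N u)" for u
    unfolding N_def using assms(1) by (rule initial_bases_flag_matroid)
  have val: "\<mu> i (B i) = ereal (real_of_ereal (\<mu> i (B i)))"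
    and inner: "inner_on ?E u (indicator (B i)) = sum u (B i)"
    if "B \<in> base_tuples k M" "i \<in> {1..k}" for B i u
  proof -
    have b: "B i \<in> val_bases ?E (r i) (\<mu> i)"
      using that unfolding M by (auto simp: PiE_iff)
    moreover have "valuated_matroid ?E (r i) (\<mu> i)"
      using assms(1) that(2) unfolding valuated_flag_matroid_def by blast
    ultimately show "\<mu> i (B i) = ereal (real_of_ereal (\<mu> i (B i)))"
      by (intro valuated_matroid_value)
    from b show "inner_on ?E u (indicator (B i)) = sum u (B i)"
      unfolding val_bases_def by (intro inner_on_indicator) auto
  qed
  have cell: "{B. is_arg_min (\<lambda>B. \<Sum>i = 1..k. tilted_value (\<mu> i) u (B i))
      (\<lambda>B. B \<in> base_tuples k M) B} = base_tuples k (N u)" for u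
    unfolding M unfolding N_def base_tuples_def initial_bases_def
    by (rule is_arg_min_sum_PiE) simp
  have separated: "(\<Sum>i = 1..k. \<mu> i (B i) + ereal (inner_on ?E u (indicator (B i))))
      = ereal (\<Sum>i = 1..k. tilted_value (\<mu> i) u (B i))" if "B \<in> base_tuples k M" for B u
    unfolding sum_ereal[symmetric]
  proof (rule sum.cong[OF refl])
    fix i assume i: "i \<in> {1..k}"
    show "\<mu> i (B i) + ereal (inner_on ?E u (indicator (B i))) = ereal (tilted_value (\<mu> i) u (B i))"
      unfolding tilted_value_def inner[OF that i]
      by (subst val[OF that i]) simp
  qed
  have cell2: "{B. is_arg_min
      (\<lambda>B. \<Sum>i = 1..k. (\<mu> i (B i) + ereal (inner_on ?E u (indicator (B i)))))
      (\<lambda>B. B \<in> base_tuples k M) B} = base_tuples k (N u)" for u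
    unfolding cell[symmetric] by (intro is_arg_min_cong_ereal separated)
  \<comment> \<open>The pairing with \<open>u\<close> is additive over the indicators that make up a
    base point, so the weight of the subdivision has the same separated form.\<close>
  have "(\<Sum>i = 1..k. \<mu> i (B i)) + ereal (inner_on ?E u (base_point k B))
      = ereal (\<Sum>i = 1..k. tilted_value (\<mu> i) u (B i))" if "B \<in> base_tuples k M" for B u
    unfolding separated[OF that, symmetric] unfolding inner_on_base_point sum_ereal[symmetric]
    by (rule sum.distrib[symmetric])
  then have cell1: "{B. is_arg_min
      (\<lambda>B. (\<Sum>i = 1..k. \<mu> i (B i)) + ereal (inner_on ?E u (base_point k B)))
      (\<lambda>B. B \<in> base_tuples k M) B} = base_tuples k (N u)" for u
    unfolding cell[symmetric] by (intro is_arg_min_cong_ereal)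
  show ?thesis
    unfolding flag_matroidal_def regular_subdivision_def cell1 cell2 using N by blast
qed

end
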